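(* Let $\omega\in(0,1]$, $a>0$ and $b\in\mathbb{R}\setminus\{-ak^\omega:k\in\mathbb{N}_+\}$, let $t_k:=ak^\omega+b$ for $k\in\mathbb{N}_0$, and let $\theta_k:=\frac{t_{k-1}-1}{t_k}$ for $k\in\mathbb{N}_+$. Let $x^0,x^1\in\mathbb{R}^n$ be arbitrary and let $\{x^k\}_{k\in\mathbb{N}_0}$ be generated by $$y^k=x^k+\theta_k(x^k-x^{k-1}),\qquad x^{k+1}=Ty^k,\qquad k\in\mathbb{N}_+ .$$ Let $x^*$ be any minimizer of $F$. If either $\omega\in(0,1)$ and $a>0$, or $\omega=1$ and $a\in\left(0,\frac12\right)$, then: (i) $\|x^k-x^{k-1}\|=o\left(\frac{1}{k^\omega}\right)$; (ii) $F(x^k)-F(x^* )=o\left(\frac{1}{k^{2\omega}}\right)$; (iii) $\{x^k\}_{k\in\mathbb{N}_0}$ converges to a minimizer of $F$.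
   Context: $\mathbb{N}_0$ and $\mathbb{N}_+$ denote the nonnegative and the positive integers. $\mathbb{R}^n$ carries the standard inner product $\langle\cdot,\cdot\rangle$ and Euclidean norm $\|\cdot\|$. Standing assumptions: $f:\mathbb{R}^n\to\mathbb{R}$ is convex and differentiable with $L$-Lipschitz continuous gradient ($L>0$); $g:\mathbb{R}^n\to\mathbb{R}$ is a proper lower-semicontinuous convex function, possibly nondifferentiable; $F:=f+g$ has at least one minimizer; $\beta\in\left(0,\frac1L\right]$. The proximity operator of a proper convex function $\psi$ is $\mathrm{prox}_\psi(x):=\operatorname{argmin}_{u\in\mathbb{R}^n}\left\{\frac12\|u-x\|^2+\psi(u)\right\}$, and $T:=\mathrm{prox}_{\beta g}\circ(\mathcal{I}-\beta\nabla f)$, where $\mathcal{I}$ is the identity operator. For sequences $a_k\ge0$ and $b_k>0$ tending to zero, $a_k=o(b_k)$ means $\lim_{k\to\infty}a_k/b_k=0$. *)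

theory Defs
  imports "HOL-Analysis.Analysis"
begin

definition proper :: "('a \<Rightarrow> ereal) \<Rightarrow> bool" where
  "proper g \<longleftrightarrow> (\<forall>x. g x \<noteq> - \<infinity>) \<and> (\<exists>x. g x \<noteq> \<infinity>)"

definition lower_semicontinuous :: "('a::topological_space \<Rightarrow> ereal) \<Rightarrow> bool" where
  "lower_semicontinuous g \<longleftrightarrow> (\<forall>x. g x \<le> Liminf (at x) g)"

text \<open>
  Only \<open>0 < s < 1\<close> is required: the endpoint cases are trivial, so the convention
  for \<open>0 * \<infinity>\<close> plays no role. The definition is used for functions that never take
  the value \<open>- \<infinity>\<close>, so that no sum \<open>\<infinity> + - \<infinity>\<close> occurs.
\<close>

definition ereal_convex :: "('a::real_vector \<Rightarrow> ereal) \<Rightarrow> bool" where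
  "ereal_convex g \<longleftrightarrow> (\<forall>x y s. 0 < s \<and> s < 1 \<longrightarrow>
     g ((1 - s) *\<^sub>R x + s *\<^sub>R y) \<le> ereal (1 - s) * g x + ereal s * g y)"

definition minimizer :: "('a \<Rightarrow> 'b::linorder) \<Rightarrow> 'a \<Rightarrow> bool" where
  "minimizer F x \<longleftrightarrow> is_arg_min F (\<lambda>_. True) x"

text \<open>
  On a Euclidean space the minimizer exists and is unique when \<open>\<psi>\<close> is proper, lower
  semicontinuous and convex; otherwise the value of \<open>arg_min\<close> need not be meaningful.
\<close>

definition prox :: "('a::real_inner \<Rightarrow> ereal) \<Rightarrow> 'a \<Rightarrow> 'a" where
  "prox \<psi> x = (ARG_MIN (\<lambda>u. ereal (1 / 2 * (norm (u - x))\<^sup>2) + \<psi> u) u. True)"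

text \<open>The argument \<open>f'\<close> is the gradient of the smooth part.\<close>

definition forward_backward ::
  "real \<Rightarrow> ('a::real_inner \<Rightarrow> 'a) \<Rightarrow> ('a \<Rightarrow> ereal) \<Rightarrow> 'a \<Rightarrow> 'a" where
  "forward_backward \<beta> f' g = prox (\<lambda>u. ereal \<beta> * g u) \<circ> (\<lambda>x. x - \<beta> *\<^sub>R f' x)"

text \<open>For \<open>\<omega> > 0\<close> we have \<open>0 powr \<omega> = 0\<close>, hence \<open>t_seq a \<omega> b 0 = b\<close> as intended.\<close>

definition t_seq :: "real \<Rightarrow> real \<Rightarrow> real \<Rightarrow> nat \<Rightarrow> real" where
  "t_seq a \<omega> b k = a * real k powr \<omega> + b"

text \<open>Meant for \<open>k \<ge> 1\<close> only, because of the truncated subtraction.\<close>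

definition theta_seq :: "real \<Rightarrow> real \<Rightarrow> real \<Rightarrow> nat \<Rightarrow> real" where
  "theta_seq a \<omega> b k = (t_seq a \<omega> b (k - 1) - 1) / t_seq a \<omega> b k"

end

theory Submission
  imports Defs
begin

text \<open>
  One forward-backward step \<open>p = T y\<close> satisfies, for every \<open>u\<close>,
  \<open>F p + |p - u|^2 / (2 \<beta>) \<le> F u + |y - u|^2 / (2 \<beta>)\<close>
  (\<open>forward_backward_inequality\<close>). The whole theorem is drawn from this inequality, used only
  at the previous iterate \<open>u = x k\<close> and at minimizers \<open>u = z\<close>. Write \<open>h k = F (x k) - F z\<close>,
  \<open>d k = x k - x (k - 1)\<close> and \<open>c = 1 / (2 \<beta>)\<close>.

  The difference \<open>|p - u|^2 - |y - u|^2\<close> is affine in \<open>u\<close>, so adding \<open>t k * (t k - 1)\<close> times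
  the inequality at \<open>x k\<close> and \<open>t k\<close> times the one at \<open>z\<close> gives a FISTA-type Lyapunov estimate for
  \<open>E k = t (k - 1)^2 * h k + c * |x k - z + (t (k - 1) - 1) * d k|^2\<close>. It decreases at least by
  \<open>(t (k - 1)^2 - t k^2 + t k) * h k\<close>. The increments of \<open>t\<close> stay eventually below some constant
  smaller than \<open>1 / 2\<close>: they tend to \<open>0\<close> if \<open>\<omega> < 1\<close>, and they equal \<open>a\<close> if \<open>\<omega> = 1\<close>. Hence the
  loss is at least \<open>\<delta> * t k * h k\<close>, and \<open>t k * h k\<close> is summable.

  The inequality at \<open>x k\<close> alone, multiplied by \<open>t k^2\<close>, says that
  \<open>V k = t (k - 1)^2 * (h k + c * |d k|^2)\<close> increases by at most the summable quantity
  \<open>t k * h k\<close> while losing \<open>t (k - 1) * c * |d k|^2\<close>. So \<open>V\<close> converges and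
  \<open>V k / t (k - 1)\<close> is summable; as \<open>1 / t\<close> is not summable (here \<open>\<omega> \<le> 1\<close> enters), the limit
  of \<open>V\<close> is \<open>0\<close>. This is (i) and (ii) at once, because \<open>t k\<close> grows like \<open>a * k powr \<omega>\<close>.

  For (iii), \<open>E\<close> converges, and now \<open>t (k - 1)^2 * h k\<close> and \<open>t (k - 1) * d k\<close> are known to
  vanish, so \<open>|x k - z|\<close> converges for every minimizer \<open>z\<close>. Cluster points are minimizers by lower
  semicontinuity, and Opial's argument concludes.

  Existence of the proximal point needs an affine minorant of \<open>g\<close>. Since a minimizer of \<open>F\<close>
  is given, Fermat's rule at that point (\<open>minimizer_subgradient\<close>) provides one; the same rule applied to the proximal problem produces its variational
  inequality.
\<close>

section \<open>Extended-real convex analysis\<close>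

lemma minimizer_iff: "minimizer F z \<longleftrightarrow> (\<forall>u. F z \<le> F u)"
  by (auto simp: minimizer_def is_arg_min_def not_less)

lemma lower_semicontinuous_scale:
  fixes g :: "'a::euclidean_space \<Rightarrow> ereal"
  assumes "lower_semicontinuous g" "0 < \<beta>"
  shows "lower_semicontinuous (\<lambda>u. ereal \<beta> * g u)"
  unfolding lower_semicontinuous_def
proof
  fix x
  have "Liminf (at x) (\<lambda>u. ereal \<beta> * g u) = ereal \<beta> * Liminf (at x) g"
    using assms by (intro Liminf_ereal_mult_left) auto
  then show "ereal \<beta> * g x \<le> Liminf (at x) (\<lambda>u. ereal \<beta> * g u)"
    using assms by (auto simp: lower_semicontinuous_def intro!: ereal_mult_left_mono)
qed

lemma ereal_convex_scale:
  assumes "ereal_convex g" "0 < \<beta>"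
  shows "ereal_convex (\<lambda>u. ereal \<beta> * g u)"
  unfolding ereal_convex_def
proof (intro allI impI)
  fix x y :: 'a and s :: real
  assume s: "0 < s \<and> s < 1"
  have "ereal \<beta> * g ((1 - s) *\<^sub>R x + s *\<^sub>R y)
      \<le> ereal \<beta> * (ereal (1 - s) * g x + ereal s * g y)"
    using assms s by (intro ereal_mult_left_mono) (auto simp: ereal_convex_def)
  also have "\<dots> = ereal (1 - s) * (ereal \<beta> * g x) + ereal s * (ereal \<beta> * g y)"
    using assms by (simp add: ereal_pos_distrib mult.left_commute)
  finally show "ereal \<beta> * g ((1 - s) *\<^sub>R x + s *\<^sub>R y)
      \<le> ereal (1 - s) * (ereal \<beta> * g x) + ereal s * (ereal \<beta> * g y)" .
qed

text \<open>
Letting the bounds \<open>c n\<close> vary makes this applicable to sums of \<open>g\<close> and a continuous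
function, with the continuous part moved into \<open>c\<close>.
\<close>

lemma lower_semicontinuous_sequentially:
  fixes g :: "'a::t1_space \<Rightarrow> ereal"
  assumes lsc: "lower_semicontinuous g" and u: "u \<longlonglongrightarrow> l"
    and le: "\<And>n. g (u n) \<le> ereal (c n)" and c: "c \<longlonglongrightarrow> d"
  shows "g l \<le> ereal d"
proof (rule ccontr)
  assume "\<not> g l \<le> ereal d"
  then obtain e where e: "ereal d < ereal e" "ereal e < g l"
    using ereal_dense2[of "ereal d" "g l"] by (auto simp: not_le)
  then have "ereal e < Liminf (at l) g"
    using lsc by (auto simp: lower_semicontinuous_def intro: less_le_trans)
  then have "eventually (\<lambda>v. ereal e < g v) (at l)"
    by (rule less_LiminfD)
  \<comment> \<open>The filter \<open>at l\<close> omits \<open>l\<close> itself, where the bound holds by the choice of \<open>e\<close>.\<close>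
  then have "eventually (\<lambda>v. ereal e < g v) (nhds l)"
    unfolding eventually_at_filter by eventually_elim (use e in auto)
  then have "eventually (\<lambda>n. ereal e < g (u n)) sequentially"
    using u by (auto simp: filterlim_iff)
  moreover have "eventually (\<lambda>n. c n < e) sequentially"
    using c e by (auto intro: order_tendstoD)
  ultimately have "eventually (\<lambda>n. False) sequentially"
  proof eventually_elim
    case (elim n)
    then show ?case using le[of n]
      by (meson ereal_less_le less_ereal.simps(1) less_trans less_le_not_le order_le_less_trans)
  qed
  then show False by simp
qed

lemma GDERIV_along_line:
  assumes "GDERIV f (p + s *\<^sub>R d) :> D"
  shows "((\<lambda>s. f (p + s *\<^sub>R d)) has_real_derivative D \<bullet> d) (at s)"
proof -
  have "((\<lambda>s. f (p + s *\<^sub>R d)) has_derivative (\<lambda>h. (h *\<^sub>R d) \<bullet> D)) (at s)"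
    using assms unfolding gderiv_def
    by (intro has_derivative_compose[of "\<lambda>s. p + s *\<^sub>R d" "\<lambda>h. h *\<^sub>R d" s UNIV f "\<lambda>h. h \<bullet> D"])
       (auto intro!: derivative_eq_intros)
  then show ?thesis
    by (simp add: has_field_derivative_def inner_commute mult_commute_abs)
qed

lemma derivative_le_chord:
  fixes \<phi> :: "real \<Rightarrow> real"
  assumes D: "(\<phi> has_real_derivative D) (at 0)"
    and le: "\<And>s. \<lbrakk>0 < s; s < 1\<rbrakk> \<Longrightarrow> \<phi> s - \<phi> 0 \<le> s * C"
  shows "D \<le> C"
proof (rule tendsto_upperbound)
  have "((\<lambda>s. (\<phi> s - \<phi> 0) / (s - 0)) \<longlongrightarrow> D) (at 0)"
    using D by (simp add: has_field_derivative_iff)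
  then show "((\<lambda>s. (\<phi> s - \<phi> 0) / (s - 0)) \<longlongrightarrow> D) (at_right 0)"
    by (rule filterlim_mono[OF _ order_refl at_le]) simp
  have "eventually (\<lambda>s::real. s \<in> {0<..<1}) (at_right 0)"
    by (rule eventually_at_right_real) simp
  then show "eventually (\<lambda>s. (\<phi> s - \<phi> 0) / (s - 0) \<le> C) (at_right 0)"
    by eventually_elim (use le in \<open>auto simp: divide_simps mult.commute\<close>)
qed simp

text \<open>
Fermat's rule for a smooth plus a convex function. Moving from \<open>p\<close> towards \<open>u\<close> by a fraction
\<open>s\<close>, convexity bounds the growth of \<open>g\<close> by \<open>s * (g u - g p)\<close>, and minimality forces this to
compensate the decrease of \<open>q\<close>; dividing by \<open>s\<close> and letting \<open>s\<close> tend to \<open>0\<close> leaves the gradient.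
\<close>

lemma minimizer_subgradient:
  fixes q :: "'a::real_inner \<Rightarrow> real" and g :: "'a \<Rightarrow> ereal"
  assumes D: "GDERIV q p :> D" and conv: "ereal_convex g" and not_minf: "\<And>u. g u \<noteq> - \<infinity>"
    and fin: "g p = ereal r" and min: "\<And>u. ereal (q p) + g p \<le> ereal (q u) + g u"
  shows "ereal (r - D \<bullet> (u - p)) \<le> g u"
proof (cases "g u")
  case (real c)
  have "- (D \<bullet> (u - p)) \<le> c - r"
  proof (rule derivative_le_chord)
    show "((\<lambda>s. - q (p + s *\<^sub>R (u - p))) has_real_derivative - (D \<bullet> (u - p))) (at 0)"
      using D by (intro DERIV_minus GDERIV_along_line) simp
    fix s :: real
    assume s: "0 < s" "s < 1"
    have "ereal (q p) + ereal r \<le> ereal (q ((1 - s) *\<^sub>R p + s *\<^sub>R u)) + g ((1 - s) *\<^sub>R p + s *\<^sub>R u)"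
      using min fin by metis
    also have "\<dots> \<le> ereal (q ((1 - s) *\<^sub>R p + s *\<^sub>R u)) + (ereal (1 - s) * g p + ereal s * g u)"
      using conv s by (intro add_left_mono) (auto simp: ereal_convex_def)
    finally have "q p + r \<le> q ((1 - s) *\<^sub>R p + s *\<^sub>R u) + ((1 - s) * r + s * c)"
      using real fin by simp
    moreover have "(1 - s) *\<^sub>R p + s *\<^sub>R u = p + s *\<^sub>R (u - p)"
      by (simp add: algebra_simps)
    ultimately show "- q (p + s *\<^sub>R (u - p)) - - q (p + 0 *\<^sub>R (u - p)) \<le> s * (c - r)"
      by (simp add: algebra_simps)
  qed
  then show ?thesis using real by simp
qed (use not_minf in auto)

section \<open>The forward-backward operator\<close>

text \<open>
The affine minorant makes the proximal objective coercive, so a minimizing sequence is bounded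
and lower semicontinuity passes to a cluster point. As \<open>prox\<close> chooses among the minimizers
of this objective, existence of one makes the chosen point a minimizer.
\<close>

lemma prox_attains_minimum:
  fixes \<psi> :: "'a::euclidean_space \<Rightarrow> ereal"
  assumes lsc: "lower_semicontinuous \<psi>" and dom: "\<psi> z \<noteq> \<infinity>"
    and affine: "\<And>u. ereal (c + D \<bullet> u) \<le> \<psi> u"
  shows "ereal (1 / 2 * (norm (prox \<psi> v - v))\<^sup>2) + \<psi> (prox \<psi> v)
    \<le> ereal (1 / 2 * (norm (u - v))\<^sup>2) + \<psi> u"
proof -
  define \<phi> where "\<phi> u = ereal (1 / 2 * (norm (u - v))\<^sup>2) + \<psi> u" for u
  \<comment> \<open>Young's inequality \<open>|D| r \<le> |D|^2 + r^2 / 4\<close> absorbs the linear term, hence this constant.\<close>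
  define C where "C = c + D \<bullet> v - (norm D)\<^sup>2"
  have coercive: "ereal (1 / 4 * (norm (u - v))\<^sup>2 + C) \<le> \<phi> u" for u
  proof -
    have "- (norm D * norm (u - v)) \<le> D \<bullet> (u - v)"
      using Cauchy_Schwarz_ineq2[of D "u - v"] by linarith
    moreover have "norm D * norm (u - v) \<le> (norm D)\<^sup>2 + 1 / 4 * (norm (u - v))\<^sup>2"
      using zero_le_power2[of "norm D - norm (u - v) / 2"]
      by (simp add: power2_eq_square algebra_simps)
    ultimately have "1 / 4 * (norm (u - v))\<^sup>2 + C \<le> 1 / 2 * (norm (u - v))\<^sup>2 + (c + D \<bullet> u)"
      by (simp add: C_def inner_diff_right)
    then have "ereal (1 / 4 * (norm (u - v))\<^sup>2 + C)
        \<le> ereal (1 / 2 * (norm (u - v))\<^sup>2) + ereal (c + D \<bullet> u)"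
      by simp
    also have "\<dots> \<le> \<phi> u"
      unfolding \<phi>_def by (intro add_left_mono affine)
    finally show ?thesis .
  qed
  have lower: "ereal C \<le> (INF u. \<phi> u)"
  proof (rule INF_greatest)
    fix u
    have "ereal C \<le> ereal (1 / 4 * (norm (u - v))\<^sup>2 + C)" by simp
    then show "ereal C \<le> \<phi> u" using coercive by (rule order_trans)
  qed
  have "(INF u. \<phi> u) \<le> \<phi> z" by (rule INF_lower) simp
  moreover have "\<phi> z \<noteq> \<infinity>" using dom by (simp add: \<phi>_def)
  ultimately have "(INF u. \<phi> u) \<noteq> \<infinity>" by auto
  then obtain \<mu> where \<mu>: "(INF u. \<phi> u) = ereal \<mu>"
    using lower by (cases "INF u. \<phi> u") auto
  have "\<exists>w. \<phi> w < ereal (\<mu> + 1 / real (Suc n))" for n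
  proof -
    have "(INF u. \<phi> u) < ereal (\<mu> + 1 / real (Suc n))" by (simp add: \<mu>)
    then show ?thesis by (auto simp: INF_less_iff)
  qed
  then obtain w where w: "\<And>n. \<phi> (w n) < ereal (\<mu> + 1 / real (Suc n))" by metis
  have "norm (w n - v) \<le> sqrt (4 * (\<mu> + 1 - C))" for n
  proof (rule real_le_rsqrt)
    have "ereal (1 / 4 * (norm (w n - v))\<^sup>2 + C) < ereal (\<mu> + 1 / real (Suc n))"
      using coercive w by (rule order_le_less_trans)
    then have "1 / 4 * (norm (w n - v))\<^sup>2 + C < \<mu> + 1 / real (Suc n)" by simp
    also have "\<dots> \<le> \<mu> + 1" by simp
    finally show "(norm (w n - v))\<^sup>2 \<le> 4 * (\<mu> + 1 - C)" by simp
  qed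
  then have "bounded (range w)"
    unfolding bounded_any_center[where a = v] by (auto simp: dist_norm norm_minus_commute)
  then obtain l r where r: "strict_mono (r :: nat \<Rightarrow> nat)" and l: "(w \<circ> r) \<longlonglongrightarrow> l"
    using bounded_imp_convergent_subsequence by blast
  define d where "d n = \<mu> + 1 / real (Suc n) - 1 / 2 * (norm (w n - v))\<^sup>2" for n
  have "\<psi> l \<le> ereal (\<mu> - 1 / 2 * (norm (l - v))\<^sup>2)"
  proof (rule lower_semicontinuous_sequentially[OF lsc l])
    show "\<psi> ((w \<circ> r) n) \<le> ereal ((d \<circ> r) n)" for n
      using w[of "r n"] by (cases "\<psi> (w (r n))") (auto simp: \<phi>_def d_def)
    have "(\<lambda>n. 1 / real (Suc (r n))) \<longlonglongrightarrow> 0"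
      using LIMSEQ_subseq_LIMSEQ[OF LIMSEQ_inverse_real_of_nat r]
      by (simp add: o_def inverse_eq_divide)
    moreover have "(\<lambda>n. w (r n)) \<longlonglongrightarrow> l" using l by (simp add: o_def)
    ultimately have "(\<lambda>n. \<mu> + 1 / real (Suc (r n)) - 1 / 2 * (norm (w (r n) - v))\<^sup>2)
        \<longlonglongrightarrow> \<mu> + 0 - 1 / 2 * (norm (l - v))\<^sup>2"
      by (intro tendsto_intros)
    then show "(d \<circ> r) \<longlonglongrightarrow> \<mu> - 1 / 2 * (norm (l - v))\<^sup>2"
      by (simp add: d_def o_def)
  qed
  then have "\<phi> l \<le> ereal \<mu>"
    by (cases "\<psi> l") (auto simp: \<phi>_def)
  moreover have "ereal \<mu> \<le> \<phi> u" for u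
    unfolding \<mu>[symmetric] by (rule INF_lower) simp
  ultimately have "is_arg_min \<phi> (\<lambda>_. True) l"
    unfolding is_arg_min_def by (auto simp: not_less intro: order_trans)
  then have "is_arg_min \<phi> (\<lambda>_. True) (arg_min \<phi> (\<lambda>_. True))"
    unfolding arg_min_def by (rule someI)
  moreover have "arg_min \<phi> (\<lambda>_. True) = prox \<psi> v"
    unfolding prox_def \<phi>_def ..
  ultimately have "\<phi> (prox \<psi> v) \<le> \<phi> u"
    by (auto simp: is_arg_min_def not_less)
  then show ?thesis by (simp add: \<phi>_def)
qed

text \<open>
The difference quotients of \<open>f\<close> along the segment from \<open>y\<close> to \<open>x\<close> are bounded by \<open>f x - f y\<close>.
\<close>

lemma convex_on_above_tangent:
  assumes conv: "convex_on UNIV f" and D: "GDERIV f y :> D"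
  shows "f y + D \<bullet> (x - y) \<le> f x"
proof -
  have "D \<bullet> (x - y) \<le> f x - f y"
  proof (rule derivative_le_chord)
    show "((\<lambda>s. f (y + s *\<^sub>R (x - y))) has_real_derivative D \<bullet> (x - y)) (at 0)"
      using D by (intro GDERIV_along_line) simp
    fix s :: real
    assume "0 < s" "s < 1"
    then have "f ((1 - s) *\<^sub>R y + s *\<^sub>R x) \<le> (1 - s) * f y + s * f x"
      using conv by (intro convex_onD) auto
    moreover have "(1 - s) *\<^sub>R y + s *\<^sub>R x = y + s *\<^sub>R (x - y)" by (simp add: algebra_simps)
    ultimately show "f (y + s *\<^sub>R (x - y)) - f (y + 0 *\<^sub>R (x - y)) \<le> s * (f x - f y)"
      by (simp add: algebra_simps)
  qed
  then show ?thesis by simp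
qed

text \<open>
Along the segment from \<open>y\<close> to \<open>p\<close>, the difference of the two sides has nonpositive derivative
by the Lipschitz bound on the gradient.
\<close>

lemma descent_lemma:
  assumes D: "\<And>z. GDERIV f z :> f' z" and lip: "L-lipschitz_on UNIV f'"
  shows "f p \<le> f y + f' y \<bullet> (p - y) + L / 2 * (norm (p - y))\<^sup>2"
proof -
  define d where "d = p - y"
  define \<phi> where "\<phi> s = f (y + s *\<^sub>R d) - s * (f' y \<bullet> d) - L / 2 * s\<^sup>2 * (norm d)\<^sup>2" for s
  have "\<phi> 1 \<le> \<phi> 0"
  proof (rule DERIV_nonpos_imp_nonincreasing[of 0 1 \<phi>])
    fix s :: real
    assume s: "0 \<le> s" "s \<le> 1"
    have "(\<phi> has_real_derivative
        (f' (y + s *\<^sub>R d) \<bullet> d - f' y \<bullet> d - L * s * (norm d)\<^sup>2)) (at s)"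
      unfolding \<phi>_def using GDERIV_along_line[OF D[of "y + s *\<^sub>R d"]]
      by (auto intro!: derivative_eq_intros)
    moreover have "f' (y + s *\<^sub>R d) \<bullet> d - f' y \<bullet> d \<le> L * s * (norm d)\<^sup>2"
    proof -
      have "f' (y + s *\<^sub>R d) \<bullet> d - f' y \<bullet> d \<le> norm (f' (y + s *\<^sub>R d) - f' y) * norm d"
        using norm_cauchy_schwarz[of "f' (y + s *\<^sub>R d) - f' y" d] by (simp add: inner_diff_left)
      also have "\<dots> \<le> (L * norm (s *\<^sub>R d)) * norm d"
        using lipschitz_onD[OF lip, of "y + s *\<^sub>R d" y]
        by (intro mult_right_mono) (auto simp: dist_norm)
      finally show ?thesis using s by (simp add: power2_eq_square)
    qed
    ultimately show "\<exists>D. (\<phi> has_real_derivative D) (at s) \<and> D \<le> 0" by auto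
  qed simp
  then show ?thesis by (simp add: \<phi>_def d_def)
qed

text \<open>
The variational inequality of the proximal point gives a lower bound for \<open>g x - g p\<close>. Convexity
bounds \<open>f x\<close> below by its tangent at \<open>y\<close>, and the descent lemma bounds \<open>f p\<close> above with the
error \<open>L / 2 * |p - y|^2\<close>. As \<open>\<beta> * L \<le> 1\<close>, this error is absorbed by the term
\<open>|p - y|^2 / 2\<close> that appears when the inner product is expanded by the three-point identity.
The first claim records that the iterates enter the domain of \<open>g\<close> after one step, even when the
starting points lie outside it.
\<close>

lemma forward_backward_inequality:
  fixes f :: "'a::euclidean_space \<Rightarrow> real" and g :: "'a \<Rightarrow> ereal"
  assumes conv_f: "convex_on UNIV f" and D: "\<And>z. GDERIV f z :> f' z"
    and L: "0 < L" and lip: "L-lipschitz_on UNIV f'"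
    and g: "proper g" "lower_semicontinuous g" "ereal_convex g"
    and F: "F = (\<lambda>u. ereal (f u) + g u)"
    and min: "minimizer F xs"
    and \<beta>: "0 < \<beta>" "\<beta> \<le> 1 / L"
    and p: "p = forward_backward \<beta> f' g y"
  shows "F p \<noteq> \<infinity>"
    and "F p + ereal (1 / (2 * \<beta>) * ((norm (p - x))\<^sup>2 - (norm (y - x))\<^sup>2)) \<le> F x"
proof -
  define v where "v = y - \<beta> *\<^sub>R f' y"
  define \<psi> where "\<psi> = (\<lambda>u. ereal \<beta> * g u)"
  have g_minf: "g u \<noteq> - \<infinity>" for u using g by (simp add: proper_def)
  obtain z where z: "g z \<noteq> \<infinity>" using g by (auto simp: proper_def)
  have "F xs \<le> F z" using min by (simp add: minimizer_iff)
  then have "g xs \<noteq> \<infinity>" using z by (auto simp: F)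
  then obtain r where r: "g xs = ereal r" using g_minf[of xs] by (cases "g xs") auto
  \<comment> \<open>Fermat's rule at the minimizer \<open>xs\<close> of \<open>F\<close> supplies the affine minorant of \<open>g\<close>.\<close>
  have minorant: "ereal (r - f' xs \<bullet> (u - xs)) \<le> g u" for u
    using min by (intro minimizer_subgradient[OF D g(3) g_minf r]) (simp add: minimizer_iff F)
  have \<psi>_affine: "ereal (\<beta> * (r + f' xs \<bullet> xs) + (- \<beta> *\<^sub>R f' xs) \<bullet> u) \<le> \<psi> u" for u
  proof -
    have "ereal \<beta> * ereal (r - f' xs \<bullet> (u - xs)) \<le> \<psi> u"
      unfolding \<psi>_def using \<beta> by (intro ereal_mult_left_mono minorant) simp
    then show ?thesis by (simp add: algebra_simps inner_diff_right)
  qed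
  have \<psi>_dom: "\<psi> z \<noteq> \<infinity>" using z \<beta> g_minf[of z] by (cases "g z") (auto simp: \<psi>_def)
  have p_eq: "p = prox \<psi> v" by (simp add: p forward_backward_def \<psi>_def v_def)
  have p_min: "ereal (1 / 2 * (norm (p - v))\<^sup>2) + \<psi> p \<le> ereal (1 / 2 * (norm (u - v))\<^sup>2) + \<psi> u" for u
    unfolding p_eq
    by (rule prox_attains_minimum[OF _ \<psi>_dom \<psi>_affine])
       (unfold \<psi>_def, rule lower_semicontinuous_scale[OF g(2) \<beta>(1)])
  have "\<psi> p \<noteq> \<infinity>" using p_min[of z] \<psi>_dom by auto
  then have "g p \<noteq> \<infinity>" using \<beta> by (auto simp: \<psi>_def)
  then obtain c where c: "g p = ereal c" using g_minf[of p] by (cases "g p") auto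
  show "F p \<noteq> \<infinity>" by (simp add: F c)
  have grad: "GDERIV (\<lambda>u. 1 / 2 * (norm (u - v))\<^sup>2) p :> p - v"
    unfolding gderiv_def power2_norm_eq_inner
    by (auto intro!: derivative_eq_intros simp: inner_commute)
  have sub: "ereal (\<beta> * c - (p - v) \<bullet> (x - p)) \<le> \<psi> x"
    using p_min g_minf \<beta> c ereal_convex_scale[OF g(3) \<beta>(1)]
    by (intro minimizer_subgradient[OF grad]) (auto simp: \<psi>_def)
  show "F p + ereal (1 / (2 * \<beta>) * ((norm (p - x))\<^sup>2 - (norm (y - x))\<^sup>2)) \<le> F x"
  proof (cases "g x")
    case (real e)
    have 1: "\<beta> * c - (p - v) \<bullet> (x - p) \<le> \<beta> * e"
      using sub real by (simp add: \<psi>_def)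
    have 2: "f y + f' y \<bullet> (x - y) \<le> f x"
      by (rule convex_on_above_tangent[OF conv_f D])
    have 3: "f p \<le> f y + f' y \<bullet> (p - y) + L / 2 * (norm (p - y))\<^sup>2"
      by (rule descent_lemma[OF D lip])
    have "\<beta> * L \<le> 1" using \<beta> L by (simp add: field_simps)
    then have 4: "\<beta> * L * (norm (p - y))\<^sup>2 \<le> 1 * (norm (p - y))\<^sup>2"
      by (intro mult_right_mono) auto
    have "\<beta> * (f p + f y + f' y \<bullet> (x - y))
        \<le> \<beta> * (f x + (f y + f' y \<bullet> (p - y) + L / 2 * (norm (p - y))\<^sup>2))"
      using 2 3 \<beta> by (intro mult_left_mono) auto
    then have "\<beta> * f p - \<beta> * f x \<le> \<beta> * (f' y \<bullet> (p - x)) + 1 / 2 * (norm (p - y))\<^sup>2"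
      using 4 by (simp add: algebra_simps inner_diff_right)
    moreover have "(p - v) \<bullet> (x - p) = (p - y) \<bullet> (x - p) - \<beta> * (f' y \<bullet> (p - x))"
      by (simp add: v_def algebra_simps inner_diff_right inner_diff_left inner_add_left)
    moreover have "(norm (y - x))\<^sup>2 = (norm (p - y))\<^sup>2 + (norm (p - x))\<^sup>2 + 2 * ((p - y) \<bullet> (x - p))"
      by (simp add: power2_norm_eq_inner algebra_simps inner_commute)
    ultimately have "\<beta> * (f p + c) + 1 / 2 * ((norm (p - x))\<^sup>2 - (norm (y - x))\<^sup>2) \<le> \<beta> * (f x + e)"
      using 1 by (simp add: algebra_simps)
    then have "f p + c + 1 / (2 * \<beta>) * ((norm (p - x))\<^sup>2 - (norm (y - x))\<^sup>2) \<le> f x + e"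
      using \<beta> by (simp add: field_simps)
    then show ?thesis using real c by (simp add: F)
  qed (use g_minf[of x] in \<open>auto simp: F\<close>)
qed

section \<open>Energy estimates for the inertial iteration\<close>

text \<open>
A nonnegative sequence that decreases up to summable errors \<open>B\<close> converges, and its losses \<open>A\<close>
are summable: correcting \<open>E\<close> by the partial sums of both makes it decreasing and bounded below.
\<close>

lemma quasi_decreasing_convergent:
  fixes E A B :: "nat \<Rightarrow> real"
  assumes E: "\<And>k. 0 \<le> E k" and A: "\<And>k. 0 \<le> A k" and B: "\<And>k. 0 \<le> B k"
    and step: "\<And>k. E (Suc k) + A k \<le> E k + B k" and sB: "summable B"
  shows "summable A" and "convergent E"
proof -
  have telescope: "E n + (\<Sum>k<n. A k) \<le> E 0 + (\<Sum>k<n. B k)" for n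
  proof (induction n)
    case (Suc n)
    then show ?case using step[of n] by simp
  qed simp
  have B_le: "(\<Sum>k<n. B k) \<le> suminf B" for n
    using B sB by (intro sum_le_suminf) auto
  show sA: "summable A"
  proof (rule bounded_imp_summable[of _ "E 0 + suminf B"])
    fix n
    show "(\<Sum>k\<le>n. A k) \<le> E 0 + suminf B"
      using telescope[of "Suc n"] B_le[of "Suc n"] E[of "Suc n"]
      by (simp add: lessThan_Suc_atMost)
  qed (use A in auto)
  define G where "G n = E n + (\<Sum>k<n. A k) - (\<Sum>k<n. B k)" for n
  have "decseq G"
    by (rule decseq_SucI) (use step in \<open>simp add: G_def algebra_simps\<close>)
  moreover have "- suminf B \<le> G n" for n
    using E[of n] B_le[of n] sum_nonneg[of "{..<n}" A] A by (simp add: G_def)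
  ultimately have "convergent G"
    using decseq_convergent by (metis convergentI)
  then have "convergent (\<lambda>n. G n - (\<Sum>k<n. A k) + (\<Sum>k<n. B k))"
    using sA sB by (intro convergent_add convergent_diff) (auto simp: summable_iff_convergent)
  then show "convergent E" by (simp add: G_def)
qed

text \<open>
A positive limit of \<open>V\<close> would make \<open>V / t\<close> comparable with the divergent series of \<open>1 / t\<close>.
This is what turns the boundedness of the energy into a little-o rate.
\<close>

lemma convergent_weighted_summable_tendsto_0:
  fixes V t :: "nat \<Rightarrow> real"
  assumes V: "\<And>k. 0 \<le> V k" and t: "\<And>k. 0 < t k" and conv: "convergent V"
    and summ: "summable (\<lambda>k. V k / t k)" and div: "\<not> summable (\<lambda>k. 1 / t k)"
  shows "V \<longlonglongrightarrow> 0"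
proof -
  obtain l where l: "V \<longlonglongrightarrow> l" using conv by (auto simp: convergent_def)
  have "0 \<le> l" using l V by (intro LIMSEQ_le_const) auto
  moreover have "\<not> 0 < l"
  proof
    assume l0: "0 < l"
    then have "eventually (\<lambda>k. l / 2 < V k) sequentially"
      using l by (intro order_tendstoD) auto
    then have "eventually (\<lambda>k. norm (1 / t k) \<le> 2 / l * (V k / t k)) sequentially"
    proof eventually_elim
      case (elim k)
      then have "1 \<le> 2 / l * V k" using l0 by (simp add: field_simps)
      then have "1 / t k \<le> (2 / l * V k) / t k"
        using t[of k] by (intro divide_right_mono) auto
      then show ?case using t[of k] by simp
    qed
    then have "summable (\<lambda>k. 1 / t k)"
      using summable_mult[OF summ] by (rule summable_comparison_test_ev)
    then show False using div by simp
  qed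
  ultimately show ?thesis using l by simp
qed

text \<open>
A squared norm of \<open>\<tau> A + Z\<close> in terms of those of \<open>A\<close> and \<open>A + Z\<close>. The weights \<open>\<tau>\<^sup>2 - \<tau>\<close> and \<open>\<tau>\<close>
are the ones with which the two instances of the forward-backward inequality are combined; the
term in \<open>Z\<close> cancels when two such identities with the same \<open>Z\<close> are subtracted.
\<close>

lemma norm_sq_scaleR_add:
  fixes A Z :: "'a::real_inner"
  shows "(norm (\<tau> *\<^sub>R A + Z))\<^sup>2
    = (\<tau>\<^sup>2 - \<tau>) * (norm A)\<^sup>2 + \<tau> * (norm (A + Z))\<^sup>2 - (\<tau> - 1) * (norm Z)\<^sup>2"
  unfolding power2_norm_eq_inner
  by (simp add: inner_add_left inner_add_right inner_commute algebra_simps power2_eq_square)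

text \<open>
What the energy argument uses about the iteration, with \<open>h\<close> for the objective gap and \<open>c\<close> for
\<open>1 / (2 \<beta>)\<close>. All conditions hold from index \<open>0\<close> on; they are meant for a tail of the actual
sequences, far enough out that \<open>t\<close> is large and the gaps are finite. Consequently \<open>y k\<close> here is
the point extrapolated from \<open>x k\<close> and \<open>x (Suc k)\<close>, whose image under the forward-backward step
is \<open>x (k + 2)\<close>. The condition \<open>t_growth\<close> is where \<open>a < 1 / 2\<close> matters when \<open>\<omega> = 1\<close>.

The inequality at a minimizer \<open>z\<close> is a premise \<open>near\<close> of the lemmas instead of a condition of
the locale, since the last part of the theorem has to apply them to every minimizer.
\<close>

locale inertial_energy =
  fixes x y :: "nat \<Rightarrow> 'a::real_inner" and h t :: "nat \<Rightarrow> real" and c \<delta> :: real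
  assumes c: "0 < c" and \<delta>: "0 < \<delta>"
    and h: "\<And>k. 0 \<le> h k"
    and t: "\<And>k. 1 \<le> t k" and t_mono: "\<And>k. t k \<le> t (Suc k)"
    and t_div: "\<not> summable (\<lambda>k. 1 / t k)"
    and t_growth: "\<And>k. \<delta> * t (Suc k) \<le> (t k)\<^sup>2 - (t (Suc k))\<^sup>2 + t (Suc k)"
    and y: "\<And>k. y k = x (Suc k) + ((t k - 1) / t (Suc k)) *\<^sub>R (x (Suc k) - x k)"
    and descent: "\<And>k. h (k + 2)
      + c * ((norm (x (k + 2) - x (Suc k)))\<^sup>2 - (norm (y k - x (Suc k)))\<^sup>2) \<le> h (Suc k)"
begin

text \<open>
Let \<open>\<tau> = t (Suc k)\<close>. The extrapolation is designed so that
\<open>\<tau> * (y k - x (Suc k)) = (t k - 1) * (x (Suc k) - x k)\<close>; so the vector in \<open>E k\<close> is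
\<open>\<tau> * (y k - x (Suc k)) + (x (Suc k) - z)\<close>, and the one in \<open>E (Suc k)\<close> arises from it when \<open>y k\<close> is
replaced by \<open>x (k + 2)\<close>. Their squared norms are compared by \<open>norm_sq_scaleR_add\<close>.
\<close>

lemma energy_step:
  assumes near: "\<And>k. h (k + 2) + c * ((norm (x (k + 2) - z))\<^sup>2 - (norm (y k - z))\<^sup>2) \<le> 0"
  defines "E \<equiv> \<lambda>k. (t k)\<^sup>2 * h (Suc k)
      + c * (norm (x (Suc k) + (t k - 1) *\<^sub>R (x (Suc k) - x k) - z))\<^sup>2"
  shows "E (Suc k) + \<delta> * (t (Suc k) * h (Suc k)) \<le> E k"
proof -
  define \<tau> where "\<tau> = t (Suc k)"
  define A where "A = x (k + 2) - x (Suc k)"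
  define B where "B = y k - x (Suc k)"
  define Z where "Z = x (Suc k) - z"
  have \<tau>: "1 \<le> \<tau>" using t by (simp add: \<tau>_def)
  have B: "\<tau> *\<^sub>R B = (t k - 1) *\<^sub>R (x (Suc k) - x k)"
    using \<tau> by (simp add: B_def y \<tau>_def[symmetric])
  have p1: "x (k + 2) - z = A + Z" and p2: "y k - z = B + Z"
    by (simp_all add: A_def B_def Z_def)
  have u0: "x (Suc k) + (t k - 1) *\<^sub>R (x (Suc k) - x k) - z = \<tau> *\<^sub>R B + Z"
    unfolding B by (simp add: Z_def)
  have u1: "x (Suc (Suc k)) + (t (Suc k) - 1) *\<^sub>R (x (Suc (Suc k)) - x (Suc k)) - z = \<tau> *\<^sub>R A + Z"
    by (simp add: A_def Z_def \<tau>_def algebra_simps)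
  have "0 \<le> \<tau> * (\<tau> - 1)" using \<tau> by (intro mult_nonneg_nonneg) auto
  then have "(\<tau>\<^sup>2 - \<tau>) * (h (k + 2) + c * ((norm A)\<^sup>2 - (norm B)\<^sup>2)) \<le> (\<tau>\<^sup>2 - \<tau>) * h (Suc k)"
    using descent[of k]
    by (intro mult_left_mono) (auto simp: A_def B_def power2_eq_square algebra_simps)
  moreover have "\<tau> * (h (k + 2) + c * ((norm (A + Z))\<^sup>2 - (norm (B + Z))\<^sup>2)) \<le> \<tau> * 0"
    using near[of k] \<tau> unfolding p1 p2 by (intro mult_left_mono) auto
  ultimately have "\<tau>\<^sup>2 * h (k + 2) + c * ((norm (\<tau> *\<^sub>R A + Z))\<^sup>2 - (norm (\<tau> *\<^sub>R B + Z))\<^sup>2)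
      \<le> (\<tau>\<^sup>2 - \<tau>) * h (Suc k)"
    unfolding norm_sq_scaleR_add by (simp add: algebra_simps)
  moreover have "\<delta> * \<tau> * h (Suc k) \<le> ((t k)\<^sup>2 - \<tau>\<^sup>2 + \<tau>) * h (Suc k)"
    using t_growth[of k] h by (intro mult_right_mono) (auto simp: \<tau>_def)
  ultimately show ?thesis
    unfolding E_def u0 u1 by (simp add: \<tau>_def algebra_simps)
qed

lemma energy_convergent_and_summable:
  assumes near: "\<And>k. h (k + 2) + c * ((norm (x (k + 2) - z))\<^sup>2 - (norm (y k - z))\<^sup>2) \<le> 0"
  shows "convergent (\<lambda>k. (t k)\<^sup>2 * h (Suc k)
      + c * (norm (x (Suc k) + (t k - 1) *\<^sub>R (x (Suc k) - x k) - z))\<^sup>2)"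
    and "summable (\<lambda>k. t (Suc k) * h (Suc k))"
proof -
  define E where "E k = (t k)\<^sup>2 * h (Suc k)
      + c * (norm (x (Suc k) + (t k - 1) *\<^sub>R (x (Suc k) - x k) - z))\<^sup>2" for k
  have t_pos: "0 < t k" for k using t[of k] by linarith
  have "E (Suc k) + \<delta> * (t (Suc k) * h (Suc k)) \<le> E k + 0" for k
    using energy_step[OF near, of k] by (simp add: E_def)
  moreover have "0 \<le> E k" for k using h c by (simp add: E_def)
  moreover have "0 \<le> \<delta> * (t (Suc k) * h (Suc k))" for k
    using h[of "Suc k"] t_pos[of "Suc k"] \<delta> by simp
  ultimately have "summable (\<lambda>k. \<delta> * (t (Suc k) * h (Suc k)))" "convergent E"
    using quasi_decreasing_convergent[of E "\<lambda>k. \<delta> * (t (Suc k) * h (Suc k))" "\<lambda>_. 0"] by auto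
  then show "summable (\<lambda>k. t (Suc k) * h (Suc k))" and
    "convergent (\<lambda>k. (t k)\<^sup>2 * h (Suc k)
      + c * (norm (x (Suc k) + (t k - 1) *\<^sub>R (x (Suc k) - x k) - z))\<^sup>2)"
    using \<delta> by (simp_all add: E_def[abs_def])
qed

text \<open>
The inequality at the previous iterate, multiplied by \<open>(t (Suc k))\<^sup>2\<close>: the extrapolation turns
the kinetic term into \<open>(t k - 1)\<^sup>2 * w k\<close>, which is smaller than \<open>(t k)\<^sup>2 * w k\<close> by
\<open>(2 * t k - 1) * w k\<close>, hence by at least \<open>t k * w k\<close>. Replacing the weight of \<open>h (Suc k)\<close> by
\<open>(t k)\<^sup>2\<close> costs at most \<open>t (Suc k) * h (Suc k)\<close> by \<open>t_growth\<close>.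
\<close>

lemma mechanical_energy_step:
  defines "w \<equiv> \<lambda>k. c * (norm (x (Suc k) - x k))\<^sup>2"
  shows "(t (Suc k))\<^sup>2 * (h (k + 2) + w (Suc k)) + t k * w k
    \<le> (t k)\<^sup>2 * (h (Suc k) + w k) + t (Suc k) * h (Suc k)"
proof -
  define \<tau> where "\<tau> = t (Suc k)"
  have \<tau>: "1 \<le> \<tau>" using t by (simp add: \<tau>_def)
  have w0: "0 \<le> w k" using c by (simp add: w_def)
  have "\<tau>\<^sup>2 * (norm (y k - x (Suc k)))\<^sup>2 = (t k - 1)\<^sup>2 * (norm (x (Suc k) - x k))\<^sup>2"
    using \<tau> by (simp add: y \<tau>_def[symmetric] power_divide power_mult_distrib)
  then have y_w: "\<tau>\<^sup>2 * (c * (norm (y k - x (Suc k)))\<^sup>2) = (t k - 1)\<^sup>2 * w k"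
    by (simp add: w_def algebra_simps)
  have "\<tau>\<^sup>2 * (h (k + 2) + w (Suc k) - c * (norm (y k - x (Suc k)))\<^sup>2) \<le> \<tau>\<^sup>2 * h (Suc k)"
    using descent[of k] by (intro mult_left_mono) (auto simp: w_def algebra_simps)
  then have 1: "\<tau>\<^sup>2 * (h (k + 2) + w (Suc k)) \<le> \<tau>\<^sup>2 * h (Suc k) + (t k - 1)\<^sup>2 * w k"
    using y_w by (simp add: algebra_simps)
  have "0 \<le> \<delta> * \<tau>" using \<delta> \<tau> by simp
  then have "\<tau>\<^sup>2 * h (Suc k) \<le> ((t k)\<^sup>2 + \<tau>) * h (Suc k)"
    using t_growth[of k] h by (intro mult_right_mono) (auto simp: \<tau>_def)
  moreover have "1 * w k \<le> t k * w k" using t w0 by (intro mult_right_mono) auto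
  ultimately show ?thesis
    using 1 by (simp add: \<tau>_def power2_eq_square algebra_simps)
qed

text \<open>
The sum \<open>V\<close> of potential and kinetic energy, weighted by \<open>t\<^sup>2\<close>, converges. Divided by \<open>t\<close> it is
summable, because both of its parts are, and so its limit is \<open>0\<close>.
\<close>

lemma rates:
  assumes near: "\<And>k. h (k + 2) + c * ((norm (x (k + 2) - z))\<^sup>2 - (norm (y k - z))\<^sup>2) \<le> 0"
  shows "(\<lambda>k. (t k)\<^sup>2 * h (Suc k)) \<longlonglongrightarrow> 0" and "(\<lambda>k. t k * norm (x (Suc k) - x k)) \<longlonglongrightarrow> 0"
proof -
  define w where "w k = c * (norm (x (Suc k) - x k))\<^sup>2" for k
  define V where "V k = (t k)\<^sup>2 * (h (Suc k) + w k)" for k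
  have t_pos: "0 < t k" for k using t[of k] by linarith
  have w: "0 \<le> w k" for k using c by (simp add: w_def)
  have V: "0 \<le> V k" for k using h w by (simp add: V_def)
  have sum_h: "summable (\<lambda>k. t (Suc k) * h (Suc k))"
    by (rule energy_convergent_and_summable[OF near])
  have "V (Suc k) + t k * w k \<le> V k + t (Suc k) * h (Suc k)" for k
    using mechanical_energy_step[of k] by (simp add: V_def w_def)
  then have sum_w: "summable (\<lambda>k. t k * w k)" and conv: "convergent V"
    using w h t_pos
    by (intro quasi_decreasing_convergent[where E = V and A = "\<lambda>k. t k * w k", OF V _ _ _ sum_h];
        simp add: less_imp_le)+
  have "summable (\<lambda>k. t (Suc k) * h (Suc k) + t k * w k)"
    using sum_h sum_w by (rule summable_add)
  moreover have "norm (V k / t k) \<le> t (Suc k) * h (Suc k) + t k * w k" for k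
  proof -
    have "V k / t k = t k * h (Suc k) + t k * w k"
      using t_pos[of k] by (simp add: V_def power2_eq_square field_simps)
    moreover have "t k * h (Suc k) \<le> t (Suc k) * h (Suc k)"
      using t_mono h by (intro mult_right_mono) auto
    moreover have "0 \<le> V k / t k" using V t_pos[of k] by simp
    ultimately show ?thesis by simp
  qed
  ultimately have "summable (\<lambda>k. V k / t k)"
    by (rule summable_comparison_test'[where N = 0])
  then have V0: "V \<longlonglongrightarrow> 0"
    by (rule convergent_weighted_summable_tendsto_0[OF V t_pos conv _ t_div])
  show "(\<lambda>k. (t k)\<^sup>2 * h (Suc k)) \<longlonglongrightarrow> 0"
  proof (rule tendsto_sandwich[OF _ _ tendsto_const V0])
    show "\<forall>\<^sub>F k in sequentially. (t k)\<^sup>2 * h (Suc k) \<le> V k"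
      using w by (auto simp: V_def algebra_simps)
  qed (use h in auto)
  have "(\<lambda>k. (t k * norm (x (Suc k) - x k))\<^sup>2) \<longlonglongrightarrow> 0"
  proof (rule tendsto_sandwich[OF _ _ tendsto_const])
    show "(\<lambda>k. V k / c) \<longlonglongrightarrow> 0" using tendsto_divide[OF V0 tendsto_const, of c] c by simp
    show "\<forall>\<^sub>F k in sequentially. (t k * norm (x (Suc k) - x k))\<^sup>2 \<le> V k / c"
      using h c by (auto simp: V_def w_def field_simps power_mult_distrib)
  qed auto
  from tendsto_real_sqrt[OF this] show "(\<lambda>k. t k * norm (x (Suc k) - x k)) \<longlonglongrightarrow> 0"
    using t_pos by (simp add: real_sqrt_abs abs_mult less_imp_le)
qed

text \<open>
By \<open>rates\<close>, the convergent energy differs from \<open>c * (norm (x (Suc k) - z))\<^sup>2\<close> by vanishing terms.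
\<close>

lemma distance_convergent:
  assumes near: "\<And>k. h (k + 2) + c * ((norm (x (k + 2) - z))\<^sup>2 - (norm (y k - z))\<^sup>2) \<le> 0"
  shows "convergent (\<lambda>k. norm (x k - z))"
proof -
  define d where "d k = (t k - 1) *\<^sub>R (x (Suc k) - x k)" for k
  define u where "u k = norm (x (Suc k) + d k - z)" for k
  obtain e where e: "(\<lambda>k. (t k)\<^sup>2 * h (Suc k) + c * (u k)\<^sup>2) \<longlonglongrightarrow> e"
    using energy_convergent_and_summable(1)[OF near] by (auto simp: convergent_def u_def d_def)
  have "(\<lambda>k. ((t k)\<^sup>2 * h (Suc k) + c * (u k)\<^sup>2 - (t k)\<^sup>2 * h (Suc k)) / c) \<longlonglongrightarrow> (e - 0) / c"
    using c by (intro tendsto_intros e rates(1)[OF near]) auto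
  then have "(\<lambda>k. (u k)\<^sup>2) \<longlonglongrightarrow> e / c" using c by simp
  from tendsto_real_sqrt[OF this] have u: "u \<longlonglongrightarrow> sqrt (e / c)"
    by (simp add: u_def[abs_def])
  have "d \<longlonglongrightarrow> 0"
  proof (rule Lim_null_comparison)
    show "\<forall>\<^sub>F k in sequentially. norm (d k) \<le> t k * norm (x (Suc k) - x k)"
      using t by (auto simp: d_def intro!: always_eventually mult_right_mono)
  qed (rule rates(2)[OF near])
  have "(\<lambda>k. u k - norm (x (Suc k) - z)) \<longlonglongrightarrow> 0"
  proof (rule Lim_null_comparison)
    show "\<forall>\<^sub>F k in sequentially. norm (u k - norm (x (Suc k) - z)) \<le> norm (d k)"
    proof (intro always_eventually allI)
      fix k
      show "norm (u k - norm (x (Suc k) - z)) \<le> norm (d k)"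
        using norm_triangle_ineq3[of "x (Suc k) + d k - z" "x (Suc k) - z"]
        by (simp add: u_def algebra_simps)
    qed
    show "(\<lambda>k. norm (d k)) \<longlonglongrightarrow> 0" using \<open>d \<longlonglongrightarrow> 0\<close> by (rule tendsto_norm_zero)
  qed
  from tendsto_diff[OF u this] have "(\<lambda>k. norm (x (Suc k) - z)) \<longlonglongrightarrow> sqrt (e / c)" by simp
  then have "(\<lambda>k. norm (x k - z)) \<longlonglongrightarrow> sqrt (e / c)" by (rule LIMSEQ_imp_Suc)
  then show ?thesis by (auto simp: convergent_def)
qed

end

text \<open>
The sequence is bounded. It has a cluster point in \<open>S\<close>, its distance to that point converges,
and the limit must be \<open>0\<close> along the subsequence.
\<close>

lemma opial:
  fixes x :: "nat \<Rightarrow> 'a::euclidean_space"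
  assumes dist: "\<And>z. z \<in> S \<Longrightarrow> convergent (\<lambda>k. norm (x k - z))" and ne: "z0 \<in> S"
    and cluster: "\<And>r l. \<lbrakk>strict_mono r; (x \<circ> r) \<longlonglongrightarrow> l\<rbrakk> \<Longrightarrow> l \<in> S"
  shows "\<exists>z\<in>S. x \<longlonglongrightarrow> z"
proof -
  have "Bseq (\<lambda>k. norm (x k - z0))" using dist[OF ne] by (rule convergent_imp_Bseq)
  then obtain K where "\<And>k. norm (x k - z0) \<le> K" by (auto simp: Bseq_def)
  then have "bounded (range x)"
    unfolding bounded_any_center[where a = z0] by (auto simp: dist_norm norm_minus_commute)
  then obtain l r where r: "strict_mono (r :: nat \<Rightarrow> nat)" and l: "(x \<circ> r) \<longlonglongrightarrow> l"
    using bounded_imp_convergent_subsequence by blast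
  have "l \<in> S" using r l by (rule cluster)
  obtain m where m: "(\<lambda>k. norm (x k - l)) \<longlonglongrightarrow> m"
    using dist[OF \<open>l \<in> S\<close>] by (auto simp: convergent_def)
  have "(\<lambda>k. norm ((x \<circ> r) k - l)) \<longlonglongrightarrow> 0"
    using l by (intro tendsto_norm_zero LIM_zero)
  moreover have "(\<lambda>k. norm ((x \<circ> r) k - l)) \<longlonglongrightarrow> m"
    using LIMSEQ_subseq_LIMSEQ[OF m r] by (simp add: o_def)
  ultimately have "m = 0" by (rule LIMSEQ_unique[symmetric])
  then have "x \<longlonglongrightarrow> l" using m by (simp add: LIM_zero_cancel tendsto_norm_zero_iff)
  then show ?thesis using \<open>l \<in> S\<close> by auto
qed

section \<open>The parameter sequence\<close>

text \<open>
Bernoulli's inequality for exponents in the unit interval, in the form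
\<open>(1 + 1 / k) powr \<omega> \<le> 1 + 1 / k\<close>.
\<close>

lemma powr_increment_le:
  assumes "0 < \<omega>" "\<omega> \<le> 1" "1 \<le> k"
  shows "real (Suc k) powr \<omega> - real k powr \<omega> \<le> real k powr (\<omega> - 1)"
proof -
  have k: "0 < real k" using assms by simp
  have "real (Suc k) = real k * (1 + 1 / real k)" using k by (simp add: field_simps)
  then have "real (Suc k) powr \<omega> = real k powr \<omega> * (1 + 1 / real k) powr \<omega>"
    using k by (simp add: powr_mult)
  also have "(1 + 1 / real k) powr \<omega> \<le> (1 + 1 / real k) powr 1"
    using assms k by (intro powr_mono) auto
  then have "real k powr \<omega> * (1 + 1 / real k) powr \<omega> \<le> real k powr \<omega> * (1 + 1 / real k)"
    using k by (intro mult_left_mono) auto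
  also have "\<dots> = real k powr \<omega> + real k powr (\<omega> - 1)"
    using k by (simp add: powr_diff algebra_simps)
  finally show ?thesis by simp
qed

lemma t_seq_mono:
  assumes "0 < \<omega>" "0 < a"
  shows "t_seq a \<omega> b k \<le> t_seq a \<omega> b (Suc k)"
  using assms by (auto simp: t_seq_def intro!: mult_left_mono powr_mono2)

lemma t_seq_at_top:
  assumes "0 < \<omega>" "0 < a"
  shows "filterlim (t_seq a \<omega> b) at_top sequentially"
proof -
  have "filterlim (\<lambda>k. real k powr \<omega>) at_top sequentially"
    using assms filterlim_inverse_at_top[of "\<lambda>k. real k powr - \<omega>" sequentially]
      tendsto_neg_powr[OF _ filterlim_real_sequentially, of "- \<omega>"]
      eventually_mono[OF eventually_gt_at_top[of 0], of "\<lambda>k. 0 < real k powr - \<omega>"]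
    by (simp add: powr_minus)
  then have "filterlim (\<lambda>k. b + a * real k powr \<omega>) at_top sequentially"
    using assms
    by (intro filterlim_tendsto_add_at_top[OF tendsto_const]
          filterlim_tendsto_pos_mult_at_top[OF tendsto_const]) auto
  then show ?thesis by (simp add: t_seq_def[abs_def] add.commute)
qed

text \<open>
The increments tend to \<open>0\<close> if \<open>\<omega> < 1\<close> and are constantly \<open>a\<close> if \<open>\<omega> = 1\<close>. The threshold \<open>1 / 2\<close>
is the one below which \<open>t\<^sup>2\<close> grows by less than \<open>t\<close> in each step.
\<close>

lemma t_seq_increment_eventually:
  assumes \<omega>: "0 < \<omega>" "\<omega> \<le> 1" and a: "0 < a" and cases: "\<omega> < 1 \<or> a < 1 / 2"
  shows "\<exists>\<eta><1 / 2. \<forall>\<^sub>F k in sequentially. t_seq a \<omega> b (Suc k) - t_seq a \<omega> b k \<le> \<eta>"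
proof (cases "\<omega> < 1")
  case True
  have "(\<lambda>k. a * real k powr (\<omega> - 1)) \<longlonglongrightarrow> a * 0"
    using True by (intro tendsto_intros tendsto_neg_powr filterlim_real_sequentially) auto
  then have "\<forall>\<^sub>F k in sequentially. a * real k powr (\<omega> - 1) < 1 / 4"
    by (rule order_tendstoD) simp
  moreover have "\<forall>\<^sub>F k in sequentially. (1::nat) \<le> k" by (rule eventually_ge_at_top)
  ultimately have "\<forall>\<^sub>F k in sequentially. t_seq a \<omega> b (Suc k) - t_seq a \<omega> b k \<le> 1 / 4"
  proof eventually_elim
    case (elim k)
    have "a * (real (Suc k) powr \<omega> - real k powr \<omega>) \<le> a * real k powr (\<omega> - 1)"
      using powr_increment_le[OF \<omega>] elim a by (intro mult_left_mono) auto
    then show ?case using elim by (simp add: t_seq_def right_diff_distrib)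
  qed
  then show ?thesis by (intro exI[of _ "1 / 4"]) simp
next
  case False
  then have "\<omega> = 1" using \<omega> by simp
  then have "t_seq a \<omega> b (Suc k) - t_seq a \<omega> b k = a" for k
    by (simp add: t_seq_def algebra_simps)
  then show ?thesis using False cases by (intro exI[of _ a]) simp
qed

text \<open>
As \<open>\<omega> \<le> 1\<close>, the sequence grows at most linearly, and the harmonic series diverges.
\<close>

lemma t_seq_reciprocal_not_summable:
  assumes \<omega>: "0 < \<omega>" "\<omega> \<le> 1" and a: "0 < a" and t: "\<And>k. 1 \<le> t_seq a \<omega> b (k + N)"
  shows "\<not> summable (\<lambda>k. 1 / t_seq a \<omega> b (k + N))"
proof
  assume "summable (\<lambda>k. 1 / t_seq a \<omega> b (k + N))"
  then have "summable (\<lambda>k. (a + \<bar>b\<bar>) * (1 / t_seq a \<omega> b (k + N)))" by (rule summable_mult)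
  moreover have "norm (1 / real (Suc (k + N))) \<le> (a + \<bar>b\<bar>) * (1 / t_seq a \<omega> b (k + N))" for k
  proof -
    have "real (k + N) powr \<omega> \<le> real (Suc (k + N)) powr \<omega>"
      using \<omega> by (intro powr_mono2) auto
    also have "\<dots> \<le> real (Suc (k + N)) powr 1" using \<omega> by (intro powr_mono) auto
    finally have "a * real (k + N) powr \<omega> \<le> a * real (Suc (k + N))"
      using a by (intro mult_left_mono) auto
    moreover have "b \<le> \<bar>b\<bar> * real (Suc (k + N))"
      using mult_left_mono[of 1 "real (Suc (k + N))" "\<bar>b\<bar>"] by simp
    ultimately have "t_seq a \<omega> b (k + N) \<le> (a + \<bar>b\<bar>) * real (Suc (k + N))"
      by (simp add: t_seq_def distrib_right)
    moreover have "0 < t_seq a \<omega> b (k + N)" using t[of k] by linarith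
    ultimately show ?thesis by (simp add: divide_simps mult.commute)
  qed
  ultimately have "summable (\<lambda>k. 1 / real (Suc (k + N)))"
    by (rule summable_comparison_test'[where N = 0])
  then have "summable (\<lambda>k. inverse (real (k + Suc N)))" by (simp add: inverse_eq_divide)
  then have "summable (\<lambda>k. inverse (real k))" by (rule summable_iff_shift[THEN iffD1])
  then show False using not_summable_harmonic[where 'a = real] by simp
qed

text \<open>
If the increments are at most \<open>\<eta> < 1 / 2\<close>, then \<open>t\<^sup>2\<close> increases by at most
\<open>2 * \<eta> * t (Suc k)\<close>, which gives the last property with \<open>\<delta> = 1 - 2 * \<eta>\<close>. The middle one carries
rates in terms of \<open>t k\<close> over to rates in terms of \<open>Suc k\<close>.
\<close>

lemma t_seq_growth_eventually:
  assumes \<omega>: "0 < \<omega>" "\<omega> \<le> 1" and a: "0 < a" and cases: "\<omega> < 1 \<or> a < 1 / 2"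
  shows "\<exists>\<delta>>0. \<forall>\<^sub>F k in sequentially. 1 \<le> t_seq a \<omega> b k
    \<and> real (Suc k) powr \<omega> \<le> 2 / a * t_seq a \<omega> b k
    \<and> \<delta> * t_seq a \<omega> b (Suc k)
        \<le> (t_seq a \<omega> b k)\<^sup>2 - (t_seq a \<omega> b (Suc k))\<^sup>2 + t_seq a \<omega> b (Suc k)"
proof -
  define t where "t = t_seq a \<omega> b"
  obtain \<eta> where \<eta>: "\<eta> < 1 / 2" and inc: "\<forall>\<^sub>F k in sequentially. t (Suc k) - t k \<le> \<eta>"
    using t_seq_increment_eventually[OF \<omega> a cases] by (auto simp: t_def)
  \<comment> \<open>\<open>t k \<ge> 1 - b\<close> leaves room for the offset in \<open>a * real (Suc k) powr \<omega> \<le> 2 * t k\<close>.\<close>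
  have top: "\<forall>\<^sub>F k in sequentially. max 1 (1 - b) \<le> t k"
    using t_seq_at_top[OF \<omega>(1) a, of b] unfolding filterlim_at_top t_def by blast
  have "\<forall>\<^sub>F k in sequentially. 1 \<le> t k \<and> real (Suc k) powr \<omega> \<le> 2 / a * t k
      \<and> (1 - 2 * \<eta>) * t (Suc k) \<le> (t k)\<^sup>2 - (t (Suc k))\<^sup>2 + t (Suc k)"
    using inc top
  proof eventually_elim
    case (elim k)
    have mono: "t k \<le> t (Suc k)" using t_seq_mono[OF \<omega>(1) a] by (simp add: t_def)
    have "a * real (Suc k) powr \<omega> = t (Suc k) - b" by (simp add: t_def t_seq_def)
    then have "a * real (Suc k) powr \<omega> \<le> 2 * t k" using elim \<eta> mono by linarith
    then have "real (Suc k) powr \<omega> \<le> 2 / a * t k" using a by (simp add: field_simps)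
    moreover have "(t (Suc k) - t k) * (t (Suc k) + t k) \<le> \<eta> * (2 * t (Suc k))"
      using elim mono by (intro mult_mono) auto
    then have "(1 - 2 * \<eta>) * t (Suc k) \<le> (t k)\<^sup>2 - (t (Suc k))\<^sup>2 + t (Suc k)"
      by (simp add: power2_eq_square algebra_simps)
    ultimately show ?case using elim by simp
  qed
  then show ?thesis using \<eta> by (intro exI[of _ "1 - 2 * \<eta>"]) (auto simp: t_def)
qed

section \<open>Rates and convergence\<close>

theorem theorem3p1:
  fixes f :: "real ^ 'n \<Rightarrow> real" and f' :: "real ^ 'n \<Rightarrow> real ^ 'n"
    and g :: "real ^ 'n \<Rightarrow> ereal" and F :: "real ^ 'n \<Rightarrow> ereal"
    and L \<beta> \<omega> a b :: real
    and x y :: "nat \<Rightarrow> real ^ 'n" and xs :: "real ^ 'n"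
  assumes "convex_on UNIV f"
    and "\<forall>z. GDERIV f z :> f' z"
    and "L > 0" and "L-lipschitz_on UNIV f'"
    and "proper g" and "lower_semicontinuous g" and "ereal_convex g"
    and "F = (\<lambda>u. ereal (f u) + g u)"
    and "\<exists>z. minimizer F z"
    and "\<beta> \<in> {0<..1 / L}"
    and "\<omega> \<in> {0<..1}" and "a > 0" and "b \<notin> {- a * real k powr \<omega> | k :: nat. k \<ge> 1}"
    and "\<forall>k\<ge>1. y k = x k + theta_seq a \<omega> b k *\<^sub>R (x k - x (k - 1))"
    and "\<forall>k\<ge>1. x (k + 1) = forward_backward \<beta> f' g (y k)"
    and "minimizer F xs"
    and "(\<omega> \<in> {0<..<1} \<and> a > 0) \<or> (\<omega> = 1 \<and> a \<in> {0<..<1 / 2})"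
  shows "(\<lambda>k. norm (x k - x (k - 1)) / (1 / real k powr \<omega>)) \<longlonglongrightarrow> 0
    \<and> (\<lambda>k. (F (x k) - F xs) / ereal (1 / real k powr (2 * \<omega>))) \<longlonglongrightarrow> 0
    \<and> (\<exists>z. minimizer F z \<and> x \<longlonglongrightarrow> z)"
proof -
  have conv_f: "convex_on UNIV f" and D: "\<And>z. GDERIV f z :> f' z"
    and L: "0 < L" and lip: "L-lipschitz_on UNIV f'"
    and g: "proper g" "lower_semicontinuous g" "ereal_convex g"
    and F: "F = (\<lambda>u. ereal (f u) + g u)" and \<beta>: "0 < \<beta>" "\<beta> \<le> 1 / L"
    and \<omega>: "0 < \<omega>" "\<omega> \<le> 1" and a: "0 < a" and cases: "\<omega> < 1 \<or> a < 1 / 2"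
    and min: "minimizer F xs"
    using assms by auto
  define t where "t = t_seq a \<omega> b"
  obtain \<delta> where \<delta>: "0 < \<delta>"
    and ev: "\<forall>\<^sub>F k in sequentially. 1 \<le> t k \<and> real (Suc k) powr \<omega> \<le> 2 / a * t k
      \<and> \<delta> * t (Suc k) \<le> (t k)\<^sup>2 - (t (Suc k))\<^sup>2 + t (Suc k)"
    using t_seq_growth_eventually[OF \<omega> a cases] unfolding t_def by blast
  \<comment> \<open>From index \<open>2\<close> on, the iterates are values of the operator, so \<open>F\<close> is finite there.\<close>
  obtain M where M: "2 \<le> M"
    and t1: "\<And>k. M \<le> k \<Longrightarrow> 1 \<le> t k"
    and t_powr: "\<And>k. M \<le> k \<Longrightarrow> real (Suc k) powr \<omega> \<le> 2 / a * t k"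
    and t_growth: "\<And>k. M \<le> k \<Longrightarrow> \<delta> * t (Suc k) \<le> (t k)\<^sup>2 - (t (Suc k))\<^sup>2 + t (Suc k)"
    using eventually_conj[OF ev eventually_ge_at_top[of 2]]
    unfolding eventually_sequentially by (metis order_refl)
  have F_minf: "F u \<noteq> - \<infinity>" for u using g by (simp add: F proper_def)
  have T: "x (Suc k) = forward_backward \<beta> f' g (y k)" if "1 \<le> k" for k
    using assms(15) that by simp
  note fb = forward_backward_inequality[OF conv_f D L lip g F min \<beta>]
  have fin: "F (x k) \<noteq> \<infinity>" if "2 \<le> k" for k
    using fb(1)[OF T[of "k - 1"]] that by simp
  define Fr where "Fr u = real_of_ereal (F u)" for u
  have Fx: "F (x k) = ereal (Fr (x k))" if "2 \<le> k" for k
    using fin[OF that] F_minf[of "x k"] by (cases "F (x k)") (auto simp: Fr_def)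
  have min_eq: "F z = F xs" if "minimizer F z" for z
    using that min by (auto simp: minimizer_iff intro: antisym)
  have "F xs \<le> F (x 2)" using min by (simp add: minimizer_iff)
  then have Fxs: "F xs = ereal (Fr xs)"
    using fin[of 2] F_minf[of xs] by (cases "F xs") (auto simp: Fr_def)
  define c where "c = 1 / (2 * \<beta>)"
  define h where "h k = Fr (x k) - Fr xs" for k
  have h_nonneg: "0 \<le> h k" if "2 \<le> k" for k
  proof -
    have "F xs \<le> F (x k)" using min by (simp add: minimizer_iff)
    then show ?thesis using Fx[OF that] Fxs by (simp add: h_def)
  qed
  have descent: "h (Suc k) + c * ((norm (x (Suc k) - x k))\<^sup>2 - (norm (y k - x k))\<^sup>2) \<le> h k"
    if "2 \<le> k" for k
    using fb(2)[OF T[of k], of "x k"] that Fx[of k] Fx[of "Suc k"] by (simp add: h_def c_def)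
  have near: "h (Suc k) + c * ((norm (x (Suc k) - z))\<^sup>2 - (norm (y k - z))\<^sup>2) \<le> 0"
    if "2 \<le> k" "minimizer F z" for k z
    using fb(2)[OF T[of k], of z] that Fx[of "Suc k"] min_eq[of z] Fxs by (simp add: h_def c_def)
  interpret inertial_energy "\<lambda>k. x (k + M)" "\<lambda>k. y (Suc (k + M))" "\<lambda>k. h (k + M)"
    "\<lambda>k. t (k + M)" c \<delta>
  proof
    show "0 < c" using \<beta> by (simp add: c_def)
    show "0 < \<delta>" by (rule \<delta>)
    fix k
    show "0 \<le> h (k + M)" using h_nonneg M by simp
    show "1 \<le> t (k + M)" using t1 by simp
    show "t (k + M) \<le> t (Suc k + M)" using t_seq_mono[OF \<omega>(1) a] by (simp add: t_def)
    show "\<not> summable (\<lambda>k. 1 / t (k + M))"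
      using t_seq_reciprocal_not_summable[OF \<omega> a] t1 by (simp add: t_def)
    show "\<delta> * t (Suc k + M) \<le> (t (k + M))\<^sup>2 - (t (Suc k + M))\<^sup>2 + t (Suc k + M)"
      using t_growth[of "k + M"] by simp
    show "y (Suc (k + M)) = x (Suc k + M)
        + ((t (k + M) - 1) / t (Suc k + M)) *\<^sub>R (x (Suc k + M) - x (k + M))"
      using assms(14) by (simp add: theta_seq_def t_def)
    show "h (k + 2 + M) + c * ((norm (x (k + 2 + M) - x (Suc k + M)))\<^sup>2
        - (norm (y (Suc (k + M)) - x (Suc k + M)))\<^sup>2) \<le> h (Suc k + M)"
      using descent[of "Suc (k + M)"] M by simp
  qed
  have near': "h (k + 2 + M) + c * ((norm (x (k + 2 + M) - z))\<^sup>2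
      - (norm (y (Suc (k + M)) - z))\<^sup>2) \<le> 0" if "minimizer F z" for k z
    using near[of "Suc (k + M)" z] M that by simp

  have "(\<lambda>k. norm (x k - x (k - 1)) / (1 / real k powr \<omega>)) \<longlonglongrightarrow> 0"
  proof (rule LIMSEQ_offset[of _ "Suc M"], rule Lim_null_comparison)
    show "(\<lambda>k. 2 / a * (t (k + M) * norm (x (Suc k + M) - x (k + M)))) \<longlonglongrightarrow> 0"
      using tendsto_mult[OF tendsto_const rates(2)[OF near'[OF min]], of "2 / a"] by simp
    show "\<forall>\<^sub>F k in sequentially. norm (norm (x (k + Suc M) - x (k + Suc M - 1))
        / (1 / real (k + Suc M) powr \<omega>)) \<le> 2 / a * (t (k + M) * norm (x (Suc k + M) - x (k + M)))"
    proof (intro always_eventually allI)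
      fix k
      show "norm (norm (x (k + Suc M) - x (k + Suc M - 1)) / (1 / real (k + Suc M) powr \<omega>))
          \<le> 2 / a * (t (k + M) * norm (x (Suc k + M) - x (k + M)))"
        using mult_right_mono[OF t_powr[of "k + M"], of "norm (x (Suc (k + M)) - x (k + M))"]
        by (simp add: algebra_simps)
    qed
  qed
  moreover
  have h_rate: "(\<lambda>k. h (k + Suc M) * (real (k + Suc M) powr \<omega>)\<^sup>2) \<longlonglongrightarrow> 0"
  proof (rule Lim_null_comparison)
    show "(\<lambda>k. (2 / a)\<^sup>2 * ((t (k + M))\<^sup>2 * h (Suc k + M))) \<longlonglongrightarrow> 0"
      using tendsto_mult[OF tendsto_const rates(1)[OF near'[OF min]], of "(2 / a)\<^sup>2"] by simp
    show "\<forall>\<^sub>F k in sequentially. norm (h (k + Suc M) * (real (k + Suc M) powr \<omega>)\<^sup>2)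
        \<le> (2 / a)\<^sup>2 * ((t (k + M))\<^sup>2 * h (Suc k + M))"
    proof (intro always_eventually allI)
      fix k
      have "(real (k + Suc M) powr \<omega>)\<^sup>2 \<le> (2 / a * t (k + M))\<^sup>2"
        using t_powr[of "k + M"] by (intro power_mono) auto
      moreover have "0 \<le> h (Suc (k + M))" using h_nonneg M by simp
      ultimately have "h (Suc (k + M)) * (real (k + Suc M) powr \<omega>)\<^sup>2
          \<le> h (Suc (k + M)) * (2 / a * t (k + M))\<^sup>2"
        by (rule mult_left_mono)
      then show "norm (h (k + Suc M) * (real (k + Suc M) powr \<omega>)\<^sup>2)
          \<le> (2 / a)\<^sup>2 * ((t (k + M))\<^sup>2 * h (Suc k + M))"
        using \<open>0 \<le> h (Suc (k + M))\<close> by (simp only: power_mult_distrib) (simp add: mult_ac)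
    qed
  qed
  have "(\<lambda>k. (F (x k) - F xs) / ereal (1 / real k powr (2 * \<omega>))) \<longlonglongrightarrow> 0"
  proof (rule LIMSEQ_offset[of _ "Suc M"])
    have quotient: "(F (x k) - F xs) / ereal (1 / real k powr (2 * \<omega>)) = ereal (h k * (real k powr \<omega>)\<^sup>2)"
      if "2 \<le> k" for k
    proof -
      have "real k powr (2 * \<omega>) = (real k powr \<omega>)\<^sup>2"
        using that by (simp add: power2_eq_square powr_add[symmetric])
      then show ?thesis using Fx[OF that] Fxs that by (simp add: h_def)
    qed
    have "(F (x (k + Suc M)) - F xs) / ereal (1 / real (k + Suc M) powr (2 * \<omega>))
        = ereal (h (k + Suc M) * (real (k + Suc M) powr \<omega>)\<^sup>2)" for k
      by (rule quotient) (use M in linarith)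
    then show "(\<lambda>k. (F (x (k + Suc M)) - F xs) / ereal (1 / real (k + Suc M) powr (2 * \<omega>)))
        \<longlonglongrightarrow> 0"
      using tendsto_ereal[OF h_rate] by (simp only: zero_ereal_def)
  qed
  moreover have "\<exists>z\<in>{z. minimizer F z}. (\<lambda>k. x (k + M)) \<longlonglongrightarrow> z"
  proof (rule opial)
    show "xs \<in> {z. minimizer F z}" using min by simp
    show "convergent (\<lambda>k. norm (x (k + M) - z))" if "z \<in> {z. minimizer F z}" for z
      using that by (intro distance_convergent near') simp
    fix r :: "nat \<Rightarrow> nat" and l
    assume r: "strict_mono r" and l: "((\<lambda>k. x (k + M)) \<circ> r) \<longlonglongrightarrow> l"
    have h0: "(\<lambda>k. h (k + M)) \<longlonglongrightarrow> 0"
    proof (rule LIMSEQ_imp_Suc, rule Lim_null_comparison[OF _ rates(1)[OF near'[OF min]]])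
      show "\<forall>\<^sub>F k in sequentially. norm (h (Suc k + M)) \<le> (t (k + M))\<^sup>2 * h (Suc k + M)"
      proof (intro always_eventually allI)
        fix k
        have "1 \<le> (t (k + M))\<^sup>2" using t1[of "k + M"] by (simp add: one_le_power)
        then show "norm (h (Suc k + M)) \<le> (t (k + M))\<^sup>2 * h (Suc k + M)"
          using mult_right_mono[of 1 "(t (k + M))\<^sup>2" "h (Suc k + M)"] h_nonneg[of "Suc k + M"] M by simp
      qed
    qed
    have f_cont: "isCont f l"
      using D[of l] unfolding gderiv_def by (rule has_derivative_continuous)
    \<comment> \<open>Only \<open>g\<close> is lower semicontinuous by assumption; the continuous \<open>f\<close> goes to the bound.\<close>
    have "g l \<le> ereal (Fr xs + 0 - f l)"
    proof (rule lower_semicontinuous_sequentially[OF g(2) l])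
      show "g (((\<lambda>k. x (k + M)) \<circ> r) k) \<le> ereal (Fr xs + h (r k + M) - f (x (r k + M)))" for k
        using Fx[of "r k + M"] M by (cases "g (x (r k + M))") (auto simp: F h_def)
      show "(\<lambda>k. Fr xs + h (r k + M) - f (x (r k + M))) \<longlonglongrightarrow> Fr xs + 0 - f l"
        using LIMSEQ_subseq_LIMSEQ[OF h0 r] isCont_tendsto_compose[OF f_cont l]
        by (intro tendsto_intros) (simp_all add: o_def)
    qed
    then have "F l \<le> F xs" by (cases "g l") (auto simp: F Fxs[unfolded F])
    then show "l \<in> {z. minimizer F z}"
      using min by (auto simp: minimizer_iff intro: order_trans)
  qed
  then have "\<exists>z. minimizer F z \<and> x \<longlonglongrightarrow> z"
    by (auto intro: LIMSEQ_offset)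
  ultimately show ?thesis by blast
qed

end
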